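(* It is possible to obtain $T$ to $n$ bits of accuracy while communicating only one qubit in one direction and using an $O(2^n)$ frequency range. Namely, the one-photon algorithm described in the context, with a tick-rate register of $n$ qubits, obtains $T$ to $n$ bits of accuracy with constant probability $4/\pi^2$; and the probability of success can be boosted to $1-\delta$ by increasing the size of the tick-rate register to $n+\log\left(2+\frac{1}{2\delta}\right)$ qubits.
   Context: Two spatially separated parties, Alice and Bob, have clocks with an unknown time difference $T$. Information about $T$ is obtained from a black box quantum procedure $\mathrm{TQH}$ (ticking qubit handshake), defined by $$\mathrm{TQH}(|k\rangle|\psi\rangle)=|k\rangle\,e^{2\pi i k\omega_0 T Z}|\psi\rangle ,\qquad Z=\begin{pmatrix}1&0\\0&-1\end{pmatrix},$$ where $\omega_0$ is a known base tick rate. The first register holds the tick rate (frequency) of the transmitted photon and may be in a superposition; the second register is the photon sent from Alice to Bob, so each use of the black box communicates one qubit. The algorithm: (1) Alice prepares a tick-rate register $R$ of $n$ qubits in the state $\frac{1}{\sqrt{2^n}}\sum_{k\in\mathbb{Z}_{2^n}}|k\rangle$, by applying a Fourier transform to $|0\rangle$, and a photon in the state $\frac{1}{\sqrt2}(|0\rangle+|1\rangle)$. (2) Alice transmits the photon to Bob with the superposition of tick rates specified in $R$, i.e. $\mathrm{TQH}$ is applied once to $R$ and the photon. (3) Bob measures the received photon; assuming without loss of generality that the outcome is $|0\rangle$, the register $R$ becomes $\frac{1}{\sqrt{2^n}}\sum_{k\in\mathbb{Z}_{2^n}}e^{2\pi i k\omega_0 T}|k\rangle$. (4) Alice applies an inverse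 Fourier transform to $R$, which yields an estimate of $\omega_0T$ and hence of $T$. This is an instance of phase estimation. *)

theory Defs
  imports "HOL-Probability.Probability"
begin

section \<open>States and operators\<close>

text \<open>
  A state of an \<open>m\<close>-qubit register is its amplitude function \<open>\<phi>\<close> on the basis
  \<open>|k\<rangle>\<close>, \<open>k < 2 ^ m\<close> (zero elsewhere).  A photon is a vector in \<open>complex ^ 2\<close>; the index type
  \<open>2\<close> has the two elements \<open>0\<close> and \<open>1\<close>, naming the basis \<open>|0\<rangle>\<close>, \<open>|1\<rangle>\<close>.
  A joint state \<open>\<Psi>\<close> stands for the sum over \<open>k\<close> of \<open>|k\<rangle> \<otimes> \<Psi> k\<close>.
\<close>

type_synonym register_state = "nat \<Rightarrow> complex"
type_synonym photon_state = "complex ^ 2"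
type_synonym joint_state = "nat \<Rightarrow> photon_state"

definition ket :: "nat \<Rightarrow> register_state" where
  "ket k = (\<lambda>j. if j = k then 1 else 0)"

definition photon_ket :: "2 \<Rightarrow> photon_state" where
  "photon_ket b = axis b 1"

definition tensor :: "register_state \<Rightarrow> photon_state \<Rightarrow> joint_state" where
  "tensor \<phi> \<psi> = (\<lambda>k. \<phi> k *s \<psi>)"

definition pauli_Z :: "complex ^ 2 ^ 2" where
  "pauli_Z = (\<chi> i j. if i = j then (if i = 0 then 1 else - 1) else 0)"

primrec mat_power :: "'a::semiring_1 ^ 'n ^ 'n \<Rightarrow> nat \<Rightarrow> 'a ^ 'n ^ 'n" where
  "mat_power A 0 = mat 1"
| "mat_power A (Suc r) = A ** mat_power A r"

definition mat_exp :: "complex ^ 'n ^ 'n \<Rightarrow> complex ^ 'n ^ 'n" where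
  "mat_exp A = (\<chi> i j. \<Sum>r. mat_power A r $ i $ j / fact r)"

text \<open>The scalar multiple \<open>c Z\<close> of a matrix is written \<open>mat c ** Z\<close>.\<close>

definition TQH :: "real \<Rightarrow> real \<Rightarrow> joint_state \<Rightarrow> joint_state" where
  "TQH \<omega>\<^sub>0 T \<Psi> =
     (\<lambda>k. mat_exp (mat (complex_of_real (2 * pi * real k * \<omega>\<^sub>0 * T) * \<i>) ** pauli_Z) *v \<Psi> k)"

lemma TQH_ket:
  "TQH \<omega>\<^sub>0 T (tensor (ket k) \<psi>) =
     tensor (ket k) (mat_exp (mat (complex_of_real (2 * pi * real k * \<omega>\<^sub>0 * T) * \<i>) ** pauli_Z) *v \<psi>)"
  by (auto simp: TQH_def tensor_def ket_def fun_eq_iff)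

definition fourier :: "nat \<Rightarrow> register_state \<Rightarrow> register_state" where
  "fourier m \<phi> = (\<lambda>j. if j < 2 ^ m
     then (\<Sum>k<2 ^ m. cis (2 * pi * real j * real k / 2 ^ m) * \<phi> k) / complex_of_real (sqrt (2 ^ m))
     else 0)"

definition inverse_fourier :: "nat \<Rightarrow> register_state \<Rightarrow> register_state" where
  "inverse_fourier m \<phi> = (\<lambda>j. if j < 2 ^ m
     then (\<Sum>k<2 ^ m. cis (- (2 * pi * real j * real k / 2 ^ m)) * \<phi> k) / complex_of_real (sqrt (2 ^ m))
     else 0)"


section \<open>Measurements in the standard basis (Born rule)\<close>

text \<open>
  \<open>embed_pmf\<close> yields the intended distribution when the weights sum to 1, which is the case
  for unit states.
\<close>

definition photon_weight :: "nat \<Rightarrow> joint_state \<Rightarrow> 2 \<Rightarrow> real" where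
  "photon_weight m \<Psi> b = (\<Sum>k<2 ^ m. (cmod (\<Psi> k $ b))\<^sup>2)"

definition measure_photon :: "nat \<Rightarrow> joint_state \<Rightarrow> 2 pmf" where
  "measure_photon m \<Psi> = embed_pmf (photon_weight m \<Psi>)"

definition register_after :: "nat \<Rightarrow> joint_state \<Rightarrow> 2 \<Rightarrow> register_state" where
  "register_after m \<Psi> b = (\<lambda>k. \<Psi> k $ b / complex_of_real (sqrt (photon_weight m \<Psi> b)))"

definition measure_register :: "nat \<Rightarrow> register_state \<Rightarrow> nat pmf" where
  "measure_register m \<phi> = embed_pmf (\<lambda>j. if j < 2 ^ m then (cmod (\<phi> j))\<^sup>2 else 0)"


section \<open>The one-photon algorithm\<close>

text \<open>
  To make the resource claims part of the statement, the parties carry a log of all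
  communicated qubits.  An entry holds the sender, the receiver and the set of tick rates
  present in the superposition with which the qubit is transmitted.
\<close>

datatype party = Alice | Bob
datatype transmission = Qubit party party "real set"

definition tick_rates :: "real \<Rightarrow> joint_state \<Rightarrow> real set" where
  "tick_rates \<omega>\<^sub>0 \<Psi> = {real k * \<omega>\<^sub>0 | k. \<Psi> k \<noteq> 0}"

definition handshake ::
  "real \<Rightarrow> real \<Rightarrow> joint_state \<times> transmission list \<Rightarrow> joint_state \<times> transmission list" where
  "handshake \<omega>\<^sub>0 T = (\<lambda>(\<Psi>, tr). (TQH \<omega>\<^sub>0 T \<Psi>, tr @ [Qubit Alice Bob (tick_rates \<omega>\<^sub>0 \<Psi>)]))"

text \<open>
  If the photon is found in \<open>|0\<rangle>\<close>, the register carries the phases of \<open>\<omega>\<^sub>0 T\<close>; if it is found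
  in \<open>|1\<rangle>\<close>, it carries those of \<open>- \<omega>\<^sub>0 T\<close>, and the sign of the readout is flipped.
\<close>

definition time_estimate :: "nat \<Rightarrow> real \<Rightarrow> 2 \<Rightarrow> nat \<Rightarrow> real" where
  "time_estimate m \<omega>\<^sub>0 b j = (if b = 0 then 1 else - 1) * (real j / 2 ^ m) / \<omega>\<^sub>0"

text \<open>
  One run with an \<open>m\<close>-qubit tick-rate register; the result consists of Bob's outcome,
  the estimate of \<open>T\<close> and the log of communicated qubits.
\<close>

definition one_photon_run :: "nat \<Rightarrow> real \<Rightarrow> real \<Rightarrow> (2 \<times> real \<times> transmission list) pmf" where
  "one_photon_run m \<omega>\<^sub>0 T =
     (let R = fourier m (ket 0);
          photon = complex_of_real (1 / sqrt 2) *s (photon_ket 0 + photon_ket 1);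
          (\<Psi>, tr) = handshake \<omega>\<^sub>0 T (tensor R photon, [])
      in do {
        b \<leftarrow> measure_photon m \<Psi>;
        j \<leftarrow> measure_register m (inverse_fourier m (register_after m \<Psi> b));
        return_pmf (b, time_estimate m \<omega>\<^sub>0 b j, tr)
      })"

definition frequency_range :: "('a \<times> 'b \<times> transmission list) pmf \<Rightarrow> real" where
  "frequency_range p =
     (let F = \<Union>{F. \<exists>(b, t, tr) \<in> set_pmf p. \<exists>s r. Qubit s r F \<in> set tr} in Sup F - Inf F)"

text \<open>
  The procedure depends on \<open>T\<close> only through \<open>\<omega>\<^sub>0 T\<close> modulo 1, so \<open>T\<close> is determined modulo the
  period \<open>1 / \<omega>\<^sub>0\<close> and accuracy is relative to that period.  Being accurate to \<open>n\<close> bits means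
  that \<open>\<omega>\<^sub>0 T'\<close> is within half a unit of the \<open>n\<close>th binary digit of \<open>\<omega>\<^sub>0 T\<close>, modulo 1.
\<close>

definition accurate_to_bits :: "nat \<Rightarrow> real \<Rightarrow> real \<Rightarrow> real \<Rightarrow> bool" where
  "accurate_to_bits n \<omega>\<^sub>0 T T' \<longleftrightarrow>
     (\<exists>z::int. \<bar>T' - T - of_int z / \<omega>\<^sub>0\<bar> \<le> 1 / 2 ^ (n + 1) / \<omega>\<^sub>0)"

definition boosted_size :: "nat \<Rightarrow> real \<Rightarrow> nat" where
  "boosted_size n \<delta> = n + nat \<lceil>log 2 (2 + 1 / (2 * \<delta>))\<rceil>"

end

(*
  With N = 2^m and theta = +- omega_0 T (the sign being that of Bob's outcome), the readout j has
  probability |S(theta - j/N)|^2 / N^2 for the geometric sum S(u) of the phases exp(2 pi i k u),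
  k < N, and |S(u)| = |sin(pi N u)| / |sin(pi u)|.  For the j nearest to N theta, Jordan's
  inequality gives probability at least 4/pi^2.

  For the boosted register let K = 2^(q-1), where q is the number of extra qubits; then K/N is
  exactly the tolerance 1/2^(n+1).  This is half the tolerance of the textbook analysis of phase
  estimation, so the textbook estimate |S(u)| <= 1/(2|u|) would lose a factor of two.  Instead,
  the weights 1/sin^2 of the inaccurate readouts are compared with a telescoping sum of
  cotangents; this bounds the failure probability by K/(4(K^2 - 1/4)) <= 1/(4(K - 1)) <= delta.
*)
theory Submission
  imports Defs
begin

section \<open>Trigonometric inequalities\<close>

text \<open>The inequality \<open>y \<le> tan y\<close> multiplied by the positive cosine. It yields
  the cotangent bound, the monotonicity behind Jordan's inequality and the quadratic lower bound for
  the sine.\<close>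

lemma sin_ge_mult_cos:
  fixes y :: real
  assumes "0 \<le> y" "y < pi / 2"
  shows "y * cos y \<le> sin y"
proof -
  have "0 < cos y"
    using assms by (intro cos_gt_zero_pi) auto
  moreover have "y \<le> tan y"
    using abs_tan_ge[of y] tan_pos_pi2_le[of y] assms by auto
  ultimately show ?thesis
    by (simp add: tan_def pos_le_divide_eq)
qed

lemma cot_le_inverse:
  fixes y :: real
  assumes "0 < y" "y < pi / 2"
  shows "cot y \<le> 1 / y"
proof -
  have "0 < sin y"
    using assms by (intro sin_gt_zero) auto
  then show ?thesis
    using sin_ge_mult_cos[of y] assms by (simp add: cot_def field_simps)
qed

text \<open>The quotient \<open>sin x / x\<close> has derivative with numerator
  \<open>x * cos x - sin x\<close>, hence decreases up to \<open>pi / 2\<close>, where its value is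
  \<open>2 / pi\<close>.\<close>

lemma Jordan_inequality:
  fixes u :: real
  assumes "0 \<le> u" "u \<le> pi / 2"
  shows "2 * u / pi \<le> sin u"
proof (cases "u = 0")
  case False
  with assms have "0 < u" by simp
  have "sin (pi / 2) / (pi / 2) \<le> sin u / u"
  proof (rule DERIV_nonpos_imp_decreasing_open[of u "pi / 2" "\<lambda>x. sin x / x"])
    fix x assume x: "u < x" "x < pi / 2"
    have "((\<lambda>x. sin x / x) has_real_derivative (cos x * x - sin x) / (x * x)) (at x)"
      using x \<open>0 < u\<close> by (auto intro!: derivative_eq_intros)
    moreover have "(cos x * x - sin x) / (x * x) \<le> 0"
      using sin_ge_mult_cos[of x] x \<open>0 < u\<close> by (intro divide_nonpos_nonneg) (auto simp: mult.commute)
    ultimately show "\<exists>y. ((\<lambda>x. sin x / x) has_real_derivative y) (at x) \<and> y \<le> 0"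
      by blast
  qed (use assms \<open>0 < u\<close> in \<open>auto intro!: continuous_intros\<close>)
  then show ?thesis
    using \<open>0 < u\<close> by (simp add: field_simps)
qed simp

text \<open>From \<open>sin x \<le> x\<close> at \<open>pi / 6\<close>, where the sine is
  1/2.\<close>

lemma three_le_pi: "3 \<le> pi"
  using sin_x_le_x[of "pi / 6"] by (simp add: sin_30)

text \<open>By the double angle formula, \<open>sin y\<close> is at least \<open>y\<close> times the
  squared cosine of \<open>y / 2\<close>; that square is one minus a squared sine, which is at most
  the square of its argument.\<close>

lemma sin_ge_mult_quadratic:
  fixes y :: real
  assumes "0 \<le> y" "y < pi"
  shows "y * (1 - (y / 2)\<^sup>2) \<le> sin y"
proof -
  have "(y / 2) * cos (y / 2) \<le> sin (y / 2)"
    using assms by (intro sin_ge_mult_cos) auto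
  moreover have "0 \<le> cos (y / 2)"
    using assms by (intro cos_ge_zero) auto
  ultimately have "2 * ((y / 2) * cos (y / 2)) * cos (y / 2) \<le> 2 * sin (y / 2) * cos (y / 2)"
    by (intro mult_right_mono) auto
  also have "2 * sin (y / 2) * cos (y / 2) = sin y"
    using sin_double[of "y / 2"] by simp
  finally have "y * (cos (y / 2))\<^sup>2 \<le> sin y"
    by (simp add: power2_eq_square mult.assoc)
  moreover have "(sin (y / 2))\<^sup>2 \<le> (y / 2)\<^sup>2"
    using abs_sin_x_le_abs_x[of "y / 2"] by (simp only: abs_le_square_iff)
  then have "1 - (y / 2)\<^sup>2 \<le> (cos (y / 2))\<^sup>2"
    by (simp add: cos_squared_eq)
  ultimately show ?thesis
    using assms by (meson mult_left_mono order_trans)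
qed

text \<open>For large \<open>N\<close> the right-hand side tends to the square of pi, which is at
  least 9. From \<open>N = 8\<close> on, \<open>pi / N\<close> is at most 1/2, so the sine loses at
  most the factor 15/16, and 9 * 15/16 still exceeds 8. This 8 becomes the constant in the final
  tail bound.\<close>

lemma pi_N_sin_ge_8:
  fixes N :: real
  assumes "8 \<le> N"
  shows "8 \<le> pi * N * sin (pi / N)"
proof -
  define y where "y = pi / N"
  have y: "0 < y" "y \<le> 1 / 2"
    using assms pi_less_4 by (auto simp: y_def field_simps)
  have "(y / 2)\<^sup>2 \<le> (1 / 4)\<^sup>2"
    using y by (intro power_mono) auto
  then have "y * (15 / 16) \<le> y * (1 - (y / 2)\<^sup>2)"
    using y by (intro mult_left_mono) (auto simp: power2_eq_square)
  also have "\<dots> \<le> sin y"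
    using y three_le_pi by (intro sin_ge_mult_quadratic) auto
  finally have "pi * N * (y * (15 / 16)) \<le> pi * N * sin y"
    using assms by (intro mult_left_mono) auto
  moreover have "pi * N * (y * (15 / 16)) = pi\<^sup>2 * (15 / 16)"
    using assms by (simp add: y_def power2_eq_square)
  moreover have "3\<^sup>2 \<le> pi\<^sup>2"
    using three_le_pi by (intro power_mono) auto
  ultimately show ?thesis
    by (simp add: y_def)
qed

text \<open>The right-hand side equals \<open>1 / (sin (y - h) * sin (y + h))\<close>, and that
  product is the squared sine of \<open>y\<close> minus the squared sine of \<open>h\<close>. Taking
  \<open>h\<close> as half the spacing of the points \<open>y\<close> makes the bounds
  telescope.\<close>

lemma inverse_sin_squared_le_cot_diff:
  fixes y h :: real
  assumes "0 < h" "h < y" "y + h < pi"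
  shows "1 / (sin y)\<^sup>2 \<le> (cot (y - h) - cot (y + h)) / sin (2 * h)"
proof -
  have pos: "0 < sin (y - h)" "0 < sin (y + h)" "0 < sin (2 * h)"
    using assms by (intro sin_gt_zero; simp)+
  have prod: "sin (y - h) * sin (y + h) = (sin y)\<^sup>2 - (sin h)\<^sup>2"
  proof -
    have "sin (y - h) * sin (y + h) = (sin y)\<^sup>2 * (cos h)\<^sup>2 - (cos y)\<^sup>2 * (sin h)\<^sup>2"
      by (simp add: sin_add sin_diff power2_eq_square algebra_simps)
    then show ?thesis
      by (simp add: cos_squared_eq algebra_simps)
  qed
  have "cot (y - h) - cot (y + h) = sin ((y + h) - (y - h)) / (sin (y - h) * sin (y + h))"
    using pos unfolding sin_diff[of "y + h" "y - h"] by (simp add: cot_def field_simps)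
  then have "(cot (y - h) - cot (y + h)) / sin (2 * h) = 1 / (sin (y - h) * sin (y + h))"
    using pos by simp
  moreover have "1 / (sin y)\<^sup>2 \<le> 1 / (sin (y - h) * sin (y + h))"
  proof (rule divide_left_mono)
    have "0 < sin y"
      using assms by (intro sin_gt_zero) auto
    then show "0 < (sin y)\<^sup>2 * (sin (y - h) * sin (y + h))"
      using pos by simp
  qed (simp_all add: prod)
  ultimately show ?thesis by simp
qed

section \<open>Geometric sums of phases\<close>

text \<open>In modulus this is the Dirichlet kernel. Divided by \<open>N\<close>, it is the
  amplitude of a readout whose phase error is \<open>u\<close>.\<close>

definition phase_sum :: "nat \<Rightarrow> real \<Rightarrow> complex" where
  "phase_sum N u = (\<Sum>k<N. cis (2 * pi * real k * u))"

text \<open>The chord of the unit circle subtending the angle \<open>2 * y\<close>.\<close>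

lemma norm_one_minus_cis: "cmod (1 - cis (2 * y)) = 2 * \<bar>sin y\<bar>"
proof -
  have "(cmod (1 - cis (2 * y)))\<^sup>2 = (1 - cos (2 * y))\<^sup>2 + (sin (2 * y))\<^sup>2"
    by (simp add: cmod_power2)
  also have "\<dots> = 2 - 2 * cos (2 * y)"
    using sin_cos_squared_add[of "2 * y"] by (simp add: power2_eq_square algebra_simps)
  also have "\<dots> = (2 * \<bar>sin y\<bar>)\<^sup>2"
    by (simp add: cos_double_sin power_mult_distrib)
  finally show ?thesis
    by (subst (asm) power2_eq_iff_nonneg) auto
qed

lemma phase_sum_geometric: "(1 - cis (2 * pi * u)) * phase_sum N u = 1 - cis (2 * pi * real N * u)"
proof -
  have cis: "cis (2 * pi * real k * u) = cis (2 * pi * u) ^ k" for k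
    using Complex.DeMoivre[of "2 * pi * u" k] by (simp add: mult_ac)
  show ?thesis
    unfolding phase_sum_def cis by (rule one_diff_power_eq[symmetric])
qed

text \<open>The closed form of the geometric sum, kept as a product so that it also covers integer
  \<open>u\<close>, where both sines vanish.\<close>

lemma norm_phase_sum: "\<bar>sin (pi * u)\<bar> * cmod (phase_sum N u) = \<bar>sin (pi * real N * u)\<bar>"
proof -
  have "cmod (1 - cis (2 * (pi * u))) * cmod (phase_sum N u) = cmod (1 - cis (2 * (pi * real N * u)))"
    using arg_cong[OF phase_sum_geometric[of u N], of cmod] by (simp add: norm_mult mult.assoc)
  then show ?thesis
    by (simp add: norm_one_minus_cis)
qed

lemma phase_sum_add_int: "phase_sum N (u + of_int z) = phase_sum N u"
proof -
  have "cis (2 * pi * real k * (u + of_int z)) = cis (2 * pi * real k * u)" for k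
  proof -
    have "2 * pi * real k * (u + of_int z) = 2 * pi * real k * u + 2 * pi * of_int (int k * z)"
      by (simp add: algebra_simps)
    then show ?thesis
      by (simp only: cis_mult[symmetric] cis_multiple_2pi Ints_of_int mult_1_right)
  qed
  then show ?thesis
    by (simp add: phase_sum_def)
qed

lemma phase_sum_root_of_unity:
  assumes "\<not> int N dvd d"
  shows "phase_sum N (of_int d / real N) = 0"
proof (cases "N = 0")
  case N: False
  have "sin (pi * (of_int d / real N)) \<noteq> 0"
  proof
    assume "sin (pi * (of_int d / real N)) = 0"
    then obtain i :: int where "pi * (of_int d / real N) = of_int i * pi"
      using sin_zero_iff_int2 by blast
    then have "real_of_int d = real_of_int (int N * i)"
      using N by (simp add: field_simps)
    then show False
      using assms by (metis dvd_triv_left of_int_eq_iff)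
  qed
  moreover have "\<bar>sin (pi * real N * (of_int d / real N))\<bar> = 0"
    using N by (simp add: sin_zero_iff_int2 mult.commute)
  ultimately show ?thesis
    using norm_phase_sum[of "of_int d / real N" N] by simp
qed (simp add: phase_sum_def)

text \<open>In the quotient of sines, the numerator has an argument of modulus at most
  \<open>pi / 2\<close> and is bounded below by Jordan's inequality, while the denominator is at
  most \<open>\<bar>pi * u\<bar>\<close>.\<close>

lemma norm_phase_sum_ge:
  assumes "N > 0" "\<bar>u\<bar> \<le> 1 / (2 * real N)"
  shows "2 * real N / pi \<le> cmod (phase_sum N u)"
proof (cases "u = 0")
  case True
  then show ?thesis
    using pi_ge_two assms(1) by (simp add: phase_sum_def field_simps)
next
  case False
  have "2 * \<bar>pi * real N * u\<bar> / pi \<le> sin \<bar>pi * real N * u\<bar>"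
    using assms by (intro Jordan_inequality) (auto simp: abs_mult field_simps)
  also have "sin \<bar>pi * real N * u\<bar> \<le> \<bar>sin (pi * real N * u)\<bar>"
    by (cases "0 \<le> pi * real N * u") auto
  finally have "2 * real N * \<bar>u\<bar> \<le> \<bar>sin (pi * real N * u)\<bar>"
    by (simp add: abs_mult)
  also have "\<dots> \<le> \<bar>pi * u\<bar> * cmod (phase_sum N u)"
    unfolding norm_phase_sum[symmetric] by (intro mult_right_mono abs_sin_x_le_abs_x) auto
  finally show ?thesis
    using False by (simp add: abs_mult field_simps)
qed

text \<open>The numerator of the closed form is at most 1. The sine stays in the denominator so that
  the cotangent comparison applies later.\<close>

lemma norm_phase_sum_squared_le:
  assumes "0 < u" "u < 1"
  shows "(cmod (phase_sum N u))\<^sup>2 \<le> 1 / (sin (pi * u))\<^sup>2"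
proof -
  have "0 < sin (pi * u)"
    using assms by (intro sin_gt_zero) auto
  moreover have "(\<bar>sin (pi * u)\<bar> * cmod (phase_sum N u))\<^sup>2 \<le> 1\<^sup>2"
    unfolding norm_phase_sum by (intro power_mono) auto
  ultimately show ?thesis
    by (simp add: power_mult_distrib field_simps)
qed

text \<open>Parseval's identity: in the expanded squares, the sum over \<open>j\<close> runs over
  roots of unity and vanishes off the diagonal \<open>k = l\<close>, leaving \<open>N\<close> terms
  equal to \<open>N\<close>. It normalizes the readout distribution.\<close>

lemma sum_norm_phase_sum_squared:
  "(\<Sum>j<N. (cmod (phase_sum N (\<theta> - real j / real N)))\<^sup>2) = (real N)\<^sup>2"
proof -
  define a where "a k l j = cis (2 * pi * (real k - real l) * (\<theta> - real j / real N))" for k l j :: nat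
  have split: "a k l j = cis (2 * pi * (real k - real l) * \<theta>)
      * cis (2 * pi * real j * (of_int (int l - int k) / real N))" for k l j
    unfolding a_def cis_mult by (rule arg_cong[of _ _ cis]) (simp add: algebra_simps diff_divide_distrib)
  have orth: "(\<Sum>j<N. a k l j) = (if l = k then of_nat N else 0)" if "k < N" "l < N" for k l
  proof (cases "l = k")
    case False
    \<comment> \<open>The difference is nonzero and of modulus below \<open>N\<close>; its sign
      decides which order of subtraction is tested.\<close>
    have "\<not> int N dvd int l - int k"
      using that False zdvd_imp_le[of "int N" "int l - int k"] zdvd_imp_le[of "int N" "int k - int l"]
      by (cases "l < k") (auto simp: dvd_diff_commute)
    from phase_sum_root_of_unity[OF this] show ?thesis
      using False unfolding split sum_distrib_left[symmetric] phase_sum_def by simp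
  qed (simp add: a_def)
  have "of_real ((cmod (phase_sum N (\<theta> - real j / real N)))\<^sup>2) = (\<Sum>k<N. \<Sum>l<N. a k l j)" for j
    unfolding complex_norm_square phase_sum_def cnj_sum sum_product cis_cnj cis_mult a_def
    by (intro sum.cong refl arg_cong[of _ _ cis]) (simp add: algebra_simps)
  then have "of_real (\<Sum>j<N. (cmod (phase_sum N (\<theta> - real j / real N)))\<^sup>2)
      = (\<Sum>j<N. \<Sum>k<N. \<Sum>l<N. a k l j)"
    by simp
  also have "\<dots> = (\<Sum>k<N. \<Sum>j<N. \<Sum>l<N. a k l j)"
    by (rule sum.swap)
  also have "\<dots> = (\<Sum>k<N. \<Sum>l<N. \<Sum>j<N. a k l j)"
    by (intro sum.cong refl sum.swap)
  also have "\<dots> = (\<Sum>k<N. \<Sum>l<N. if l = k then of_nat N else 0)"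
    by (intro sum.cong refl) (simp add: orth)
  also have "\<dots> = of_real ((real N)\<^sup>2)"
    by (simp add: power2_eq_square)
  finally show ?thesis
    by (simp only: of_real_eq_iff)
qed

section \<open>Concentration of the readout\<close>

text \<open>Changing the readout by a multiple of \<open>N\<close> shifts the phase by an integer,
  so integers can be reduced to genuine register values.\<close>

lemma phase_sum_mod:
  assumes "N > 0"
  shows "phase_sum N (\<theta> - of_int (i mod int N) / real N) = phase_sum N (\<theta> - of_int i / real N)"
proof -
  have "real_of_int i = real_of_int (i div int N) * real N + of_int (i mod int N)"
    by (metis div_mult_mod_eq of_int_add of_int_mult of_int_of_nat_eq)
  then have "\<theta> - of_int (i mod int N) / real N = (\<theta> - of_int i / real N) + of_int (i div int N)"
    using assms by (simp add: field_simps)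
  then show ?thesis
    by (simp only: phase_sum_add_int)
qed

text \<open>The witness is \<open>real N * \<theta>\<close> rounded to an integer and reduced modulo
  \<open>N\<close>; its phase error is within the range of \<open>norm_phase_sum_ge\<close>, and
  squaring \<open>2 / pi\<close> gives the constant.\<close>

lemma nearest_readout:
  assumes "N > 0"
  obtains j z where "j < N" "\<bar>real j / real N - \<theta> - of_int z\<bar> \<le> 1 / (2 * real N)"
    and "4 / pi\<^sup>2 \<le> (cmod (phase_sum N (\<theta> - real j / real N)))\<^sup>2 / (real N)\<^sup>2"
proof -
  define i where "i = round (real N * \<theta>)"
  define j where "j = nat (i mod int N)"
  have j: "real j = of_int (i mod int N)" "j < N"
    using assms by (auto simp: j_def nat_less_iff)
  have "\<bar>of_int i - real N * \<theta>\<bar> \<le> 1 / 2"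
    unfolding i_def by (rule of_int_round_abs_le)
  moreover have "\<theta> - of_int i / real N = (real N * \<theta> - of_int i) / real N"
    using assms by (simp add: field_simps)
  ultimately have near: "\<bar>\<theta> - of_int i / real N\<bar> \<le> 1 / (2 * real N)"
    using assms by (simp add: abs_divide abs_minus_commute field_simps)
  have "real_of_int i = real_of_int (i div int N) * real N + real j"
    unfolding j by (metis div_mult_mod_eq of_int_add of_int_mult of_int_of_nat_eq)
  then have "real j / real N - \<theta> - of_int (- (i div int N)) = - (\<theta> - of_int i / real N)"
    using assms by (simp add: field_simps)
  then have close: "\<bar>real j / real N - \<theta> - of_int (- (i div int N))\<bar> \<le> 1 / (2 * real N)"
    using near by (simp only: abs_minus_cancel)
  have "2 * real N / pi \<le> cmod (phase_sum N (\<theta> - real j / real N))"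
    unfolding j(1) phase_sum_mod[OF assms] using norm_phase_sum_ge[OF assms near] .
  then have "(2 * real N / pi)\<^sup>2 \<le> (cmod (phase_sum N (\<theta> - real j / real N)))\<^sup>2"
    by (intro power_mono) auto
  then have "4 / pi\<^sup>2 \<le> (cmod (phase_sum N (\<theta> - real j / real N)))\<^sup>2 / (real N)\<^sup>2"
    using assms by (simp add: power_mult_distrib power_divide field_simps)
  with j(2) close show thesis
    by (rule that)
qed

text \<open>Here \<open>l - f\<close> is the cyclic distance of a readout from the phase, in units
  of \<open>1 / N\<close>. The summands are dominated by cotangent differences, so only the two ends
  of the interval contribute.\<close>

lemma inverse_sin_squared_tail:
  fixes f :: real
  assumes "8 \<le> N" "1 \<le> K" "4 * K \<le> N" "0 \<le> f" "f < 1"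
  shows "(\<Sum>l = Suc K..N - K. 1 / (sin (pi * (real l - f) / real N))\<^sup>2) / (real N)\<^sup>2
    \<le> real K / (4 * ((real K)\<^sup>2 - 1 / 4))"
proof -
  \<comment> \<open>The cotangent half a unit below \<open>l - f\<close>; then
    \<open>g (Suc l)\<close> is the one half a unit above it.\<close>
  define g where "g l = cot (pi * (real l - 1 / 2 - f) / real N)" for l
  define s where "s = sin (pi / real N)"
  have N: "0 < real N" and KN: "4 * real K \<le> real N" and K: "1 \<le> real K"
    using assms by linarith+
  have K2: "1 \<le> (real K)\<^sup>2"
    using K by (rule one_le_power)
  have cot_bound: "cot (pi * u / real N) \<le> 1 / (pi * u / real N)" if "0 < u" "2 * u < real N" for u
  proof (rule cot_le_inverse)
    have "pi * (u / real N) < pi * (1 / 2)"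
      using that N by (intro mult_strict_left_mono) (auto simp: field_simps)
    then show "pi * u / real N < pi / 2"
      by simp
  qed (use that N in simp)
  have "8 \<le> pi * real N * s"
    unfolding s_def using assms by (intro pi_N_sin_ge_8) auto
  then have s: "0 < s"
    using N pi_gt_zero by (smt (verit) mult_pos_pos mult_nonneg_nonpos)
  have summand: "1 / (sin (pi * (real l - f) / real N))\<^sup>2 \<le> (g l - g (Suc l)) / s"
    if "l \<in> {Suc K..N - K}" for l
  proof -
    have l: "real K + 1 \<le> real l" "real l + real K \<le> real N"
      using that assms by auto
    have "1 / (sin (pi * (real l - f) / real N))\<^sup>2
      \<le> (cot (pi * (real l - f) / real N - pi / (2 * real N))
         - cot (pi * (real l - f) / real N + pi / (2 * real N))) / sin (2 * (pi / (2 * real N)))"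
    proof (rule inverse_sin_squared_le_cot_diff)
      have "pi * ((1 / 2) / real N) < pi * ((real l - f) / real N)"
        using l K N assms by (intro mult_strict_left_mono divide_strict_right_mono) auto
      then show "pi / (2 * real N) < pi * (real l - f) / real N"
        by simp
      have "pi * (real l - f) / real N + pi / (2 * real N) = pi * ((real l - f + 1 / 2) / real N)"
        using N by (simp add: field_simps)
      also have "\<dots> < pi * 1"
        using l K N assms by (intro mult_strict_left_mono) auto
      finally show "pi * (real l - f) / real N + pi / (2 * real N) < pi"
        by simp
    qed (use N in auto)
    also have "pi * (real l - f) / real N - pi / (2 * real N) = pi * (real l - 1 / 2 - f) / real N"
      using N by (simp add: field_simps)
    also have "pi * (real l - f) / real N + pi / (2 * real N) = pi * (real (Suc l) - 1 / 2 - f) / real N"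
      using N by (simp add: field_simps)
    finally show ?thesis
      by (simp add: g_def s_def)
  qed
  have "(\<Sum>l = Suc K..N - K. 1 / (sin (pi * (real l - f) / real N))\<^sup>2)
      \<le> (\<Sum>l = Suc K..N - K. (g l - g (Suc l)) / s)"
    by (rule sum_mono) (rule summand)
  also have "\<dots> = (g (Suc K) - g (Suc (N - K))) / s"
    using sum_Suc_diff[of "Suc K" "N - K" "\<lambda>l. - g l"] assms
    by (simp add: sum_divide_distrib[symmetric])
  \<comment> \<open>Reflection at \<open>pi\<close> brings the upper end close to 0, where
    \<open>cot_bound\<close> applies as it does to the lower end.\<close>
  also have "- g (Suc (N - K)) = cot (pi * (real K - 1 / 2 + f) / real N)"
  proof -
    have "pi * (real (Suc (N - K)) - 1 / 2 - f) / real N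
        = pi - pi * (real K - 1 / 2 + f) / real N"
      using N assms by (simp add: field_simps of_nat_diff)
    then show ?thesis
      by (simp add: g_def cot_def)
  qed
  then have "g (Suc K) - g (Suc (N - K))
      = cot (pi * (real K + 1 / 2 - f) / real N) + cot (pi * (real K - 1 / 2 + f) / real N)"
    by (simp add: g_def algebra_simps)
  also have "\<dots> \<le> 1 / (pi * (real K + 1 / 2 - f) / real N) + 1 / (pi * (real K - 1 / 2 + f) / real N)"
    using assms K KN by (intro add_mono cot_bound) auto
  also have "\<dots> = (real N / pi) * (1 / (real K + 1 / 2 - f) + 1 / (real K - 1 / 2 + f))"
    by (simp add: distrib_left)
  also have "1 / (real K + 1 / 2 - f) + 1 / (real K - 1 / 2 + f)
      = 2 * real K / ((real K + 1 / 2 - f) * (real K - 1 / 2 + f))"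
    using assms K by (subst add_frac_eq) auto
  also have "\<dots> \<le> 2 * real K / ((real K)\<^sup>2 - 1 / 4)"
  proof (rule divide_left_mono)
    \<comment> \<open>The excess \<open>f * (1 - f)\<close> is nonnegative, so the worst case is
      \<open>f = 0\<close>.\<close>
    have "(real K + 1 / 2 - f) * (real K - 1 / 2 + f) - ((real K)\<^sup>2 - 1 / 4) = f * (1 - f)"
      by (simp add: power2_eq_square field_simps)
    moreover have "0 \<le> f * (1 - f)"
      using assms by simp
    ultimately show "(real K)\<^sup>2 - 1 / 4 \<le> (real K + 1 / 2 - f) * (real K - 1 / 2 + f)"
      by linarith
    show "0 < (real K + 1 / 2 - f) * (real K - 1 / 2 + f) * ((real K)\<^sup>2 - 1 / 4)"
      using assms K K2 by (intro mult_pos_pos) linarith+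
  qed simp
  finally have bound: "(\<Sum>l = Suc K..N - K. 1 / (sin (pi * (real l - f) / real N))\<^sup>2)
      \<le> (real N / pi) * (2 * real K / ((real K)\<^sup>2 - 1 / 4)) / s"
    using s N by (simp add: divide_right_mono mult_left_mono)
  have cancel: "(real N / pi) * X / s / (real N)\<^sup>2 = X / (pi * real N * s)" for X
    using N s by (simp add: power2_eq_square field_simps)
  have "(\<Sum>l = Suc K..N - K. 1 / (sin (pi * (real l - f) / real N))\<^sup>2) / (real N)\<^sup>2
      \<le> (real N / pi) * (2 * real K / ((real K)\<^sup>2 - 1 / 4)) / s / (real N)\<^sup>2"
    using bound by (intro divide_right_mono) auto
  also have "\<dots> = (2 * real K / ((real K)\<^sup>2 - 1 / 4)) / (pi * real N * s)"
    by (rule cancel)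
  also have "\<dots> \<le> (2 * real K / ((real K)\<^sup>2 - 1 / 4)) / 8"
  proof (rule divide_left_mono)
    show "0 \<le> 2 * real K / ((real K)\<^sup>2 - 1 / 4)"
      using K2 by (intro divide_nonneg_nonneg) linarith+
  qed (use \<open>8 \<le> pi * real N * s\<close> in auto)
  also have "2 * X / D / 8 = X / (4 * D)" for X D :: real
    by simp
  finally show ?thesis .
qed

text \<open>Measured cyclically from the floor of \<open>real N * \<theta>\<close>, the readouts
  farther than \<open>K / N\<close> from the phase have offsets between \<open>K + 1\<close> and
  \<open>N - K\<close>, so the tail bound applies after reindexing.\<close>

lemma far_readout_le:
  assumes "8 \<le> N" "1 \<le> K" "4 * K \<le> N"
  shows "(\<Sum>j | j < N \<and> \<not> (\<exists>z::int. \<bar>real j / real N - \<theta> - of_int z\<bar> \<le> real K / real N).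
      (cmod (phase_sum N (\<theta> - real j / real N)))\<^sup>2 / (real N)\<^sup>2)
    \<le> real K / (4 * ((real K)\<^sup>2 - 1 / 4))"
proof -
  define a where "a = \<lfloor>real N * \<theta>\<rfloor>"
  define f where "f = real N * \<theta> - of_int a"
  have f: "0 \<le> f" "f < 1"
    unfolding f_def a_def by linarith+
  have N: "0 < real N" and K: "1 \<le> real K" and KN: "4 * real K \<le> real N"
    using assms by linarith+
  define Bad where "Bad = {j. j < N \<and> \<not> (\<exists>z::int. \<bar>real j / real N - \<theta> - of_int z\<bar> \<le> real K / real N)}"
  \<comment> \<open>The cyclic offset of \<open>j\<close> from \<open>a\<close>; it sends all inaccurate readouts into one interval.\<close>
  define h where "h j = nat ((int j - a) mod int N)" for j :: nat
  have h: "int (h j) = (int j - a) mod int N" for j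
    using assms by (simp add: h_def)
  have h_shift: "real (h j) = real j - of_int a - of_int ((int j - a) div int N) * real N" for j
  proof -
    have "int (h j) = int j - a - (int j - a) div int N * int N"
      by (simp add: h minus_div_mult_eq_mod)
    from arg_cong[OF this, of real_of_int] show ?thesis
      by simp
  qed
  have inj: "inj_on h Bad"
  proof (rule inj_onI)
    fix i j assume ij: "i \<in> Bad" "j \<in> Bad" "h i = h j"
    then have "(int i - a) mod int N = (int j - a) mod int N"
      using h by metis
    then have "int i mod int N = int j mod int N"
      by (metis diff_add_cancel mod_add_left_eq)
    then show "i = j"
      using ij by (simp add: Bad_def)
  qed
  \<comment> \<open>Inaccuracy is tested against two neighbouring integers: \<open>z\<close>
    excludes offsets up to \<open>K\<close>, and \<open>z + 1\<close> excludes those too close to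
    \<open>N\<close>.\<close>
  have range: "h j \<in> {Suc K..N - K}" if j: "j \<in> Bad" for j
  proof -
    define z where "z = (int j - a) div int N"
    have eq: "real (h j) - f = real N * (real j / real N - \<theta> - of_int z)"
      using N h_shift[of j] by (simp add: f_def z_def right_diff_distrib)
    have "real K / real N < \<bar>real j / real N - \<theta> - of_int z\<bar>"
      using j by (auto simp: Bad_def not_le)
    then have "real K < real N * \<bar>real j / real N - \<theta> - of_int z\<bar>"
      using N by (simp add: pos_divide_less_eq mult.commute)
    then have 1: "real K < \<bar>real (h j) - f\<bar>"
      unfolding eq using N by (simp add: abs_mult)
    have eq': "real (h j) - f - real N = real N * (real j / real N - \<theta> - of_int (z + 1))"
      using N h_shift[of j] by (simp add: f_def z_def right_diff_distrib distrib_left)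
    have "real K / real N < \<bar>real j / real N - \<theta> - of_int (z + 1)\<bar>"
      using j unfolding Bad_def not_le[symmetric] by blast
    then have "real K < real N * \<bar>real j / real N - \<theta> - of_int (z + 1)\<bar>"
      using N by (simp add: pos_divide_less_eq mult.commute)
    then have 2: "real K < \<bar>real (h j) - f - real N\<bar>"
      unfolding eq' using N by (simp add: abs_mult)
    have "h j < N"
      using assms by (simp add: h_def nat_less_iff)
    then have 3: "real (h j) + 1 \<le> real N" by linarith
    have "real K < real (h j)" "real (h j) + real K < real N + 1"
      using 1 2 3 f K by linarith+
    then show ?thesis
      by auto
  qed
  have val: "(cmod (phase_sum N (\<theta> - real j / real N)))\<^sup>2 \<le> 1 / (sin (pi * (real (h j) - f) / real N))\<^sup>2"
    if j: "j \<in> Bad" for j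
  proof -
    have hj: "real K + 1 \<le> real (h j)" "real (h j) + real K \<le> real N"
      using range[OF j] by auto
    have "\<theta> - real j / real N = (f - real (h j)) / real N + of_int (- ((int j - a) div int N))"
      using N h_shift[of j] by (simp add: f_def field_simps)
    then have "phase_sum N (\<theta> - real j / real N) = phase_sum N ((f - real (h j)) / real N)"
      by (simp only: phase_sum_add_int)
    \<comment> \<open>A shift by one period moves the negative phase error into the open unit
      interval, as \<open>norm_phase_sum_squared_le\<close> requires; reflection of the sine then
      undoes the shift.\<close>
    also have "\<dots> = phase_sum N (1 - (real (h j) - f) / real N)"
      using phase_sum_add_int[of N "(f - real (h j)) / real N" 1] by (simp add: diff_divide_distrib algebra_simps)
    also have "(cmod \<dots>)\<^sup>2 \<le> 1 / (sin (pi * (1 - (real (h j) - f) / real N)))\<^sup>2"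
      using N K f hj by (intro norm_phase_sum_squared_le) (auto simp: field_simps)
    also have "sin (pi * (1 - (real (h j) - f) / real N)) = sin (pi * (real (h j) - f) / real N)"
      using sin_pi_minus[of "pi * (real (h j) - f) / real N"] by (simp add: algebra_simps)
    finally show ?thesis .
  qed
  have "(\<Sum>j\<in>Bad. (cmod (phase_sum N (\<theta> - real j / real N)))\<^sup>2)
      \<le> (\<Sum>j\<in>Bad. 1 / (sin (pi * (real (h j) - f) / real N))\<^sup>2)"
    by (rule sum_mono) (rule val)
  also have "\<dots> = (\<Sum>l\<in>h ` Bad. 1 / (sin (pi * (real l - f) / real N))\<^sup>2)"
    using inj by (simp add: sum.reindex)
  also have "\<dots> \<le> (\<Sum>l = Suc K..N - K. 1 / (sin (pi * (real l - f) / real N))\<^sup>2)"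
    using range by (intro sum_mono2) auto
  finally have "(\<Sum>j\<in>Bad. (cmod (phase_sum N (\<theta> - real j / real N)))\<^sup>2) / (real N)\<^sup>2
      \<le> (\<Sum>l = Suc K..N - K. 1 / (sin (pi * (real l - f) / real N))\<^sup>2) / (real N)\<^sup>2"
    by (rule divide_right_mono) simp
  also have "\<dots> \<le> real K / (4 * ((real K)\<^sup>2 - 1 / 4))"
    using assms f by (rule inverse_sin_squared_tail)
  finally show ?thesis
    by (simp add: Bad_def sum_divide_distrib)
qed

section \<open>One run of the algorithm\<close>

lemma exhaust_2_zero: "b = 0 \<or> b = 1" for b :: 2
  using exhaust_2[of b] by auto

section \<open>The handshake as a diagonal phase\<close>

lemma mat_power_diagonal:
  fixes d :: "'n::finite \<Rightarrow> 'a::semiring_1"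
  assumes "\<And>i j. A $ i $ j = (if i = j then d i else 0)"
  shows "mat_power A r $ i $ j = (if i = j then d i ^ r else 0)"
proof (induction r arbitrary: i j)
  case (Suc r)
  have "mat_power A (Suc r) $ i $ j = (\<Sum>k\<in>UNIV. A $ i $ k * mat_power A r $ k $ j)"
    by (simp add: matrix_matrix_mult_def)
  also have "\<dots> = (\<Sum>k\<in>UNIV. if i = k then d i * mat_power A r $ k $ j else 0)"
    by (rule sum.cong) (auto simp: assms)
  finally show ?case
    by (simp add: Suc)
qed (simp add: mat_def)

lemma mat_exp_diagonal:
  fixes d :: "'n::finite \<Rightarrow> complex"
  assumes "\<And>i j. A $ i $ j = (if i = j then d i else 0)"
  shows "mat_exp A $ i $ j = (if i = j then exp (d i) else 0)"
proof -
  have "(\<Sum>r. z ^ r / fact r) = exp z" for z :: complex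
    by (simp add: exp_def scaleR_conv_of_real field_simps)
  then show ?thesis
    by (simp add: mat_exp_def mat_power_diagonal[OF assms])
qed

text \<open>The eigenvalue of \<open>pauli_Z\<close> on \<open>photon_ket b\<close>: outcome
  \<open>b\<close> leaves the register with the phase \<open>\<omega>\<^sub>0 * T\<close> multiplied
  by this sign.\<close>

definition outcome_sign :: "2 \<Rightarrow> real" where
  "outcome_sign b = (if b = 0 then 1 else - 1)"

lemma TQH_component:
  "TQH \<omega>\<^sub>0 T \<Psi> k $ b = cis (2 * pi * real k * (outcome_sign b * (\<omega>\<^sub>0 * T))) * \<Psi> k $ b"
proof -
  define c where "c = complex_of_real (2 * pi * real k * \<omega>\<^sub>0 * T) * \<i>"
  have diag: "(mat c ** pauli_Z) $ i $ j = (if i = j then c * of_real (outcome_sign i) else 0)" for i j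
  proof -
    have "(mat c ** pauli_Z) $ i $ j = (\<Sum>k\<in>UNIV. mat c $ i $ k * pauli_Z $ k $ j)"
      by (simp add: matrix_matrix_mult_def)
    also have "\<dots> = (\<Sum>k\<in>UNIV. if i = k then c * pauli_Z $ k $ j else 0)"
      by (rule sum.cong) (auto simp: mat_def)
    also have "\<dots> = c * pauli_Z $ i $ j"
      by simp
    finally show ?thesis
      by (auto simp: pauli_Z_def outcome_sign_def)
  qed
  have "TQH \<omega>\<^sub>0 T \<Psi> k $ b = (\<Sum>i\<in>UNIV. mat_exp (mat c ** pauli_Z) $ b $ i * \<Psi> k $ i)"
    by (simp add: TQH_def c_def matrix_vector_mult_def)
  also have "\<dots> = (\<Sum>i\<in>UNIV. if b = i then exp (c * of_real (outcome_sign b)) * \<Psi> k $ i else 0)"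
    by (rule sum.cong) (auto simp: mat_exp_diagonal[OF diag])
  also have "\<dots> = exp (c * of_real (outcome_sign b)) * \<Psi> k $ b"
    by simp
  also have "exp (c * of_real (outcome_sign b)) = cis (2 * pi * real k * (outcome_sign b * (\<omega>\<^sub>0 * T)))"
    by (simp add: c_def cis_conv_exp mult_ac)
  finally show ?thesis .
qed

definition initial_state :: "nat \<Rightarrow> joint_state" where
  "initial_state m = tensor (fourier m (ket 0)) (complex_of_real (1 / sqrt 2) *s (photon_ket 0 + photon_ket 1))"

lemma initial_state_component:
  "initial_state m k $ b = (if k < 2 ^ m then of_real (1 / (sqrt (2 ^ m) * sqrt 2)) else 0)"
proof -
  have "(photon_ket 0 + photon_ket 1) $ b = 1"
    using exhaust_2_zero[of b] by (auto simp: photon_ket_def axis_def)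
  then have "(complex_of_real (1 / sqrt 2) *s (photon_ket 0 + photon_ket 1)) $ b = of_real (1 / sqrt 2)"
    by (simp only: vector_smult_component mult_1_right)
  moreover have "fourier m (ket 0) k = (if k < 2 ^ m then of_real (1 / sqrt (2 ^ m)) else 0)"
    by (simp add: fourier_def ket_def if_distrib sum.delta cong: if_cong)
  ultimately show ?thesis
    unfolding initial_state_def tensor_def vector_smult_component by simp
qed

text \<open>The handshake multiplies amplitudes by phases only, so Bob's outcome stays uniform and
  carries no information on \<open>T\<close> by itself.\<close>

lemma photon_weight_TQH: "photon_weight m (TQH \<omega>\<^sub>0 T (initial_state m)) b = 1 / 2"
proof -
  have "(cmod (TQH \<omega>\<^sub>0 T (initial_state m) k $ b))\<^sup>2 = 1 / (2 ^ m * 2)" if "k < 2 ^ m" for k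
    using that by (simp add: TQH_component initial_state_component norm_mult norm_divide
        power_mult_distrib power_divide)
  then show ?thesis
    by (simp add: photon_weight_def)
qed

lemma pmf_measure_photon: "pmf (measure_photon m (TQH \<omega>\<^sub>0 T (initial_state m))) b = 1 / 2"
proof -
  \<comment> \<open>Total weight 1 is what lets \<open>pmf_embed_pmf\<close> recover the weights
    from \<open>embed_pmf\<close>.\<close>
  have "(\<integral>\<^sup>+ b. ennreal (photon_weight m (TQH \<omega>\<^sub>0 T (initial_state m)) b) \<partial>count_space (UNIV :: 2 set))
      = (\<Sum>b\<in>(UNIV :: 2 set). ennreal (1 / 2))"
    by (simp only: nn_integral_count_space_finite finite photon_weight_TQH)
  also have "\<dots> = ennreal (\<Sum>b\<in>(UNIV :: 2 set). 1 / 2)"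
    by (rule sum_ennreal) simp
  also have "\<dots> = 1"
    by simp
  finally show ?thesis
    by (simp add: measure_photon_def pmf_embed_pmf photon_weight_TQH)
qed

section \<open>Distribution of the register readout given Bob's outcome\<close>

definition readout :: "nat \<Rightarrow> real \<Rightarrow> real \<Rightarrow> 2 \<Rightarrow> nat pmf" where
  "readout m \<omega>\<^sub>0 T b =
     measure_register m (inverse_fourier m (register_after m (TQH \<omega>\<^sub>0 T (initial_state m)) b))"

text \<open>The phase left by the handshake and that of the inverse transform combine into one phase
  linear in \<open>k\<close>; the normalizations of the register and of the transform multiply to
  \<open>1 / 2 ^ m\<close>.\<close>

lemma inverse_fourier_register_after:
  assumes "j < 2 ^ m"
  shows "inverse_fourier m (register_after m (TQH \<omega>\<^sub>0 T (initial_state m)) b) j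
    = phase_sum (2 ^ m) (outcome_sign b * (\<omega>\<^sub>0 * T) - real j / 2 ^ m) / 2 ^ m"
proof -
  have summand: "cis (- (2 * pi * real j * real k / 2 ^ m))
      * register_after m (TQH \<omega>\<^sub>0 T (initial_state m)) b k
      = cis (2 * pi * real k * (outcome_sign b * (\<omega>\<^sub>0 * T) - real j / 2 ^ m)) / of_real (sqrt (2 ^ m))"
    if "k < 2 ^ m" for k
  proof -
    \<comment> \<open>Renormalization after the measurement divides by the root of 1/2, cancelling
      the photon amplitude.\<close>
    have "complex_of_real (sqrt 2) * complex_of_real (sqrt (1 / 2)) = 1"
      by (simp flip: of_real_mult real_sqrt_mult)
    then have "register_after m (TQH \<omega>\<^sub>0 T (initial_state m)) b k
        = cis (2 * pi * real k * (outcome_sign b * (\<omega>\<^sub>0 * T))) / of_real (sqrt (2 ^ m))"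
      using that by (simp add: register_after_def photon_weight_TQH TQH_component initial_state_component
          mult.assoc)
    then show ?thesis
      by (simp add: cis_mult algebra_simps)
  qed
  have "of_real (sqrt (2 ^ m)) * of_real (sqrt (2 ^ m)) = (2 ^ m :: complex)"
    by (simp flip: of_real_mult)
  then show ?thesis
    using assms by (simp add: inverse_fourier_def summand phase_sum_def flip: sum_divide_distrib)
qed

text \<open>Parseval's identity in \<open>sum_norm_phase_sum_squared\<close> supplies the total
  weight 1.\<close>

lemma pmf_readout:
  "pmf (readout m \<omega>\<^sub>0 T b) j = (if j < 2 ^ m
     then (cmod (phase_sum (2 ^ m) (outcome_sign b * (\<omega>\<^sub>0 * T) - real j / 2 ^ m)))\<^sup>2 / (2 ^ m)\<^sup>2 else 0)"
proof -
  define w where "w j = (if j < 2 ^ m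
    then (cmod (phase_sum (2 ^ m) (outcome_sign b * (\<omega>\<^sub>0 * T) - real j / 2 ^ m)))\<^sup>2 / (2 ^ m)\<^sup>2 else 0)" for j
  have readout: "readout m \<omega>\<^sub>0 T b = embed_pmf w"
    unfolding readout_def measure_register_def
    by (rule arg_cong[of _ _ embed_pmf])
      (auto simp: fun_eq_iff w_def inverse_fourier_register_after norm_divide norm_power power_divide)
  have nonneg: "0 \<le> w j" for j
    by (simp add: w_def)
  have "(\<integral>\<^sup>+ j. ennreal (w j) \<partial>count_space UNIV) = (\<integral>\<^sup>+ j. ennreal (w j) \<partial>count_space {..<2 ^ m})"
    by (rule nn_integral_count_space_eq) (auto simp: w_def)
  also have "\<dots> = ennreal (\<Sum>j<2 ^ m. w j)"
    using nonneg by (simp add: nn_integral_count_space_finite)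
  also have "(\<Sum>j<2 ^ m. w j) = 1"
    using sum_norm_phase_sum_squared[of "2 ^ m" "outcome_sign b * (\<omega>\<^sub>0 * T)"]
    by (simp add: w_def flip: sum_divide_distrib)
  finally show ?thesis
    using nonneg by (simp add: readout pmf_embed_pmf w_def)
qed

section \<open>Communication log and frequency range\<close>

definition run_log :: "nat \<Rightarrow> real \<Rightarrow> transmission list" where
  "run_log m \<omega>\<^sub>0 = [Qubit Alice Bob (tick_rates \<omega>\<^sub>0 (initial_state m))]"

lemma one_photon_run_eq:
  "one_photon_run m \<omega>\<^sub>0 T = do {
     b \<leftarrow> measure_photon m (TQH \<omega>\<^sub>0 T (initial_state m));
     map_pmf (\<lambda>j. (b, time_estimate m \<omega>\<^sub>0 b j, run_log m \<omega>\<^sub>0)) (readout m \<omega>\<^sub>0 T b)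
   }"
  unfolding one_photon_run_def Let_def initial_state_def[symmetric] handshake_def
  by (simp add: readout_def run_log_def map_pmf_def)

lemma run_log_support: "(b, t, tr) \<in> set_pmf (one_photon_run m \<omega>\<^sub>0 T) \<Longrightarrow> tr = run_log m \<omega>\<^sub>0"
  by (auto simp: one_photon_run_eq)

text \<open>Every possible result carries the same one-entry log, so the union is a single set of
  rates: the multiples of \<open>\<omega>\<^sub>0\<close> with factor below
  \<open>2 ^ m\<close>.\<close>

lemma frequency_range_one_photon_run:
  assumes "0 < \<omega>\<^sub>0"
  shows "frequency_range (one_photon_run m \<omega>\<^sub>0 T) \<le> \<omega>\<^sub>0 * 2 ^ m"
proof -
  define F where "F = tick_rates \<omega>\<^sub>0 (initial_state m)"
  obtain b t tr where "(b, t, tr) \<in> set_pmf (one_photon_run m \<omega>\<^sub>0 T)"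
    using set_pmf_not_empty[of "one_photon_run m \<omega>\<^sub>0 T"] by (metis ex_in_conv surj_pair)
  moreover from run_log_support[OF this] have "Qubit Alice Bob F \<in> set tr"
    by (simp add: run_log_def F_def)
  moreover have "G = F" if "(b, t, tr) \<in> set_pmf (one_photon_run m \<omega>\<^sub>0 T)" "Qubit s r G \<in> set tr"
    for b t tr s r G
    using that(2) run_log_support[OF that(1)] by (simp add: run_log_def F_def)
  ultimately have "{F. \<exists>(b, t, tr) \<in> set_pmf (one_photon_run m \<omega>\<^sub>0 T). \<exists>s r. Qubit s r F \<in> set tr} = {F}"
    by blast
  then have union: "\<Union>{F. \<exists>(b, t, tr) \<in> set_pmf (one_photon_run m \<omega>\<^sub>0 T). \<exists>s r. Qubit s r F \<in> set tr} = F"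
    by simp
  have nonzero: "initial_state m k \<noteq> 0 \<longleftrightarrow> k < 2 ^ m" for k
    by (simp add: vec_eq_iff initial_state_component)
  have F: "F = (\<lambda>k. real k * \<omega>\<^sub>0) ` {..<2 ^ m}"
    by (auto simp: F_def tick_rates_def nonzero)
  have "F \<noteq> {}"
    by (auto simp: F lessThan_empty_iff)
  moreover have "x \<le> \<omega>\<^sub>0 * 2 ^ m" if x: "x \<in> F" for x
  proof -
    obtain k :: nat where "x = real k * \<omega>\<^sub>0" "k < 2 ^ m"
      using x by (auto simp: F)
    moreover from this have "real k \<le> 2 ^ m"
      by (metis less_imp_le of_nat_le_iff of_nat_numeral of_nat_power)
    ultimately show ?thesis
      using assms by (simp add: mult.commute)
  qed
  moreover have "0 \<le> x" if "x \<in> F" for x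
    using that assms by (auto simp: F)
  ultimately have "Sup F \<le> \<omega>\<^sub>0 * 2 ^ m" "0 \<le> Inf F"
    by (auto intro: cSup_least cInf_greatest)
  then show ?thesis
    by (simp add: frequency_range_def union)
qed

section \<open>From readout probabilities to the whole run\<close>

lemma prob_one_photon_run:
  "measure_pmf.prob (one_photon_run m \<omega>\<^sub>0 T) X
    = (\<Sum>b\<in>UNIV. measure_pmf.prob (readout m \<omega>\<^sub>0 T b) {j. (b, time_estimate m \<omega>\<^sub>0 b j, run_log m \<omega>\<^sub>0) \<in> X}) / 2"
proof -
  have "emeasure (one_photon_run m \<omega>\<^sub>0 T) X
      = (\<Sum>b\<in>UNIV. ennreal (1 / 2) * emeasure (readout m \<omega>\<^sub>0 T b)
          {j. (b, time_estimate m \<omega>\<^sub>0 b j, run_log m \<omega>\<^sub>0) \<in> X})"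
    by (simp add: one_photon_run_eq nn_integral_measure_pmf nn_integral_count_space_finite
        pmf_measure_photon vimage_def)
  also have "\<dots> = (\<Sum>b\<in>UNIV. ennreal (1 / 2 * measure_pmf.prob (readout m \<omega>\<^sub>0 T b)
          {j. (b, time_estimate m \<omega>\<^sub>0 b j, run_log m \<omega>\<^sub>0) \<in> X}))"
    by (intro sum.cong refl, subst ennreal_mult') (simp_all add: measure_pmf.emeasure_eq_measure)
  also have "\<dots> = ennreal (\<Sum>b\<in>UNIV. 1 / 2 * measure_pmf.prob (readout m \<omega>\<^sub>0 T b)
          {j. (b, time_estimate m \<omega>\<^sub>0 b j, run_log m \<omega>\<^sub>0) \<in> X})"
    by (rule sum_ennreal) simp
  finally show ?thesis
    by (simp add: measure_pmf.emeasure_eq_measure sum_nonneg flip: sum_divide_distrib)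
qed

text \<open>Scaling by \<open>\<omega>\<^sub>0\<close> turns accuracy of the estimate into closeness
  modulo 1 of the raw readout to the signed phase, the form in which the concentration bounds are
  proved.\<close>

lemma accurate_time_estimate_iff:
  assumes "0 < \<omega>\<^sub>0"
  shows "accurate_to_bits n \<omega>\<^sub>0 T (time_estimate m \<omega>\<^sub>0 b j) \<longleftrightarrow>
    (\<exists>z::int. \<bar>real j / 2 ^ m - outcome_sign b * (\<omega>\<^sub>0 * T) - of_int z\<bar> \<le> 1 / 2 ^ (n + 1))"
proof -
  define s where "s = outcome_sign b"
  have s: "s = 1 \<or> s = - 1"
    by (simp add: s_def outcome_sign_def)
  have scale: "\<bar>time_estimate m \<omega>\<^sub>0 b j - T - of_int z / \<omega>\<^sub>0\<bar> \<le> 1 / 2 ^ (n + 1) / \<omega>\<^sub>0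
    \<longleftrightarrow> \<bar>s * (real j / 2 ^ m) - \<omega>\<^sub>0 * T - of_int z\<bar> \<le> 1 / 2 ^ (n + 1)" for z
  proof -
    have "time_estimate m \<omega>\<^sub>0 b j - T - of_int z / \<omega>\<^sub>0 = (s * (real j / 2 ^ m) - \<omega>\<^sub>0 * T - of_int z) / \<omega>\<^sub>0"
      using assms by (simp add: time_estimate_def s_def outcome_sign_def diff_divide_distrib)
    then show ?thesis
      using assms by (simp only: abs_divide abs_of_pos divide_le_cancel) auto
  qed
  show ?thesis
    unfolding accurate_to_bits_def scale s_def[symmetric] using s
  proof
    assume s: "s = - 1"
    \<comment> \<open>For outcome 1 both the readout sign and the integer are negated, which
      preserves the distance.\<close>
    have flip: "\<bar>s * (real j / 2 ^ m) - \<omega>\<^sub>0 * T - of_int z\<bar> = \<bar>real j / 2 ^ m - s * (\<omega>\<^sub>0 * T) - of_int (- z)\<bar>" for z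
    proof -
      have "s * (real j / 2 ^ m) - \<omega>\<^sub>0 * T - of_int z = - (real j / 2 ^ m - s * (\<omega>\<^sub>0 * T) - of_int (- z))"
        by (simp add: s)
      then show ?thesis
        by (simp only: abs_minus_cancel)
    qed
    show "(\<exists>z. \<bar>s * (real j / 2 ^ m) - \<omega>\<^sub>0 * T - of_int z\<bar> \<le> 1 / 2 ^ (n + 1))
      \<longleftrightarrow> (\<exists>z. \<bar>real j / 2 ^ m - s * (\<omega>\<^sub>0 * T) - of_int z\<bar> \<le> 1 / 2 ^ (n + 1))"
      unfolding flip by (metis minus_minus)
  qed simp
qed

text \<open>A bound uniform in Bob's outcome survives averaging over the two equally likely
  outcomes. Conditioning on \<open>c\<close> selects one summand, and its factor 1/2 cancels against
  the probability of \<open>c\<close>.\<close>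

lemma prob_one_photon_run_accurate:
  assumes "\<And>b. p \<le> measure_pmf.prob (readout m \<omega>\<^sub>0 T b) {j. accurate_to_bits n \<omega>\<^sub>0 T (time_estimate m \<omega>\<^sub>0 b j)}"
  shows "p \<le> \<P>((b, t, tr) in one_photon_run m \<omega>\<^sub>0 T. accurate_to_bits n \<omega>\<^sub>0 T t)"
    and "p \<le> \<P>(x in one_photon_run m \<omega>\<^sub>0 T. accurate_to_bits n \<omega>\<^sub>0 T (fst (snd x)) \<bar> fst x = c)"
proof -
  let ?Q = "\<lambda>b. measure_pmf.prob (readout m \<omega>\<^sub>0 T b) {j. accurate_to_bits n \<omega>\<^sub>0 T (time_estimate m \<omega>\<^sub>0 b j)}"
  have "(\<Sum>b\<in>(UNIV :: 2 set). p) \<le> (\<Sum>b\<in>UNIV. ?Q b)"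
    by (intro sum_mono assms)
  then show "p \<le> \<P>((b, t, tr) in one_photon_run m \<omega>\<^sub>0 T. accurate_to_bits n \<omega>\<^sub>0 T t)"
    by (simp add: prob_one_photon_run)
  have "\<P>(x in one_photon_run m \<omega>\<^sub>0 T. accurate_to_bits n \<omega>\<^sub>0 T (fst (snd x)) \<and> fst x = c)
      = (\<Sum>b\<in>UNIV. if b = c then ?Q b else 0) / 2"
    unfolding prob_one_photon_run by (intro arg_cong2[of _ _ _ _ "(/)"] sum.cong refl) auto
  then have joint: "\<P>(x in one_photon_run m \<omega>\<^sub>0 T. accurate_to_bits n \<omega>\<^sub>0 T (fst (snd x)) \<and> fst x = c) = ?Q c / 2"
    by simp
  have "\<P>(x in one_photon_run m \<omega>\<^sub>0 T. fst x = c) = (\<Sum>b\<in>UNIV. if b = c then 1 else 0) / 2"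
    unfolding prob_one_photon_run by (intro arg_cong2[of _ _ _ _ "(/)"] sum.cong refl) auto
  then have marginal: "\<P>(x in one_photon_run m \<omega>\<^sub>0 T. fst x = c) = 1 / 2"
    by simp
  show "p \<le> \<P>(x in one_photon_run m \<omega>\<^sub>0 T. accurate_to_bits n \<omega>\<^sub>0 T (fst (snd x)) \<bar> fst x = c)"
    using assms[of c] unfolding cond_prob_def joint marginal by simp
qed

section \<open>Success probabilities for the two register sizes\<close>

lemma readout_accurate_nearest:
  assumes "0 < \<omega>\<^sub>0"
  shows "4 / pi\<^sup>2 \<le> measure_pmf.prob (readout n \<omega>\<^sub>0 T b) {j. accurate_to_bits n \<omega>\<^sub>0 T (time_estimate n \<omega>\<^sub>0 b j)}"
proof -
  have "(2 ^ n :: nat) > 0" by simp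
  then obtain j and z :: int where j: "j < 2 ^ n"
    "\<bar>real j / real (2 ^ n) - outcome_sign b * (\<omega>\<^sub>0 * T) - of_int z\<bar> \<le> 1 / (2 * real (2 ^ n))"
    "4 / pi\<^sup>2 \<le> (cmod (phase_sum (2 ^ n) (outcome_sign b * (\<omega>\<^sub>0 * T) - real j / real (2 ^ n))))\<^sup>2 / (real (2 ^ n))\<^sup>2"
    by (rule nearest_readout)
  \<comment> \<open>The nearest readout alone carries the whole bound; its error
    \<open>1 / (2 * 2 ^ n)\<close> is exactly the tolerance.\<close>
  have "4 / pi\<^sup>2 \<le> pmf (readout n \<omega>\<^sub>0 T b) j"
    using j by (simp add: pmf_readout)
  also have "\<dots> \<le> measure_pmf.prob (readout n \<omega>\<^sub>0 T b) {j. accurate_to_bits n \<omega>\<^sub>0 T (time_estimate n \<omega>\<^sub>0 b j)}"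
    unfolding pmf.rep_eq using j(2)
    by (intro measure_pmf.finite_measure_mono) (auto simp: accurate_time_estimate_iff[OF assms])
  finally show ?thesis .
qed

lemma readout_accurate_boosted:
  assumes "0 < \<omega>\<^sub>0" "0 < \<delta>"
  shows "1 - \<delta> \<le> measure_pmf.prob (readout (boosted_size n \<delta>) \<omega>\<^sub>0 T b)
    {j. accurate_to_bits n \<omega>\<^sub>0 T (time_estimate (boosted_size n \<delta>) \<omega>\<^sub>0 b j)}"
proof -
  define q where "q = nat \<lceil>log 2 (2 + 1 / (2 * \<delta>))\<rceil>"
  define m where "m = boosted_size n \<delta>"
  have "log 2 (2 + 1 / (2 * \<delta>)) \<le> real q"
    unfolding q_def by (rule real_nat_ceiling_ge)
  then have "2 + 1 / (2 * \<delta>) \<le> 2 powr real q"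
    using assms by (subst (asm) log_le_iff) (auto intro: add_pos_pos)
  then have q: "2 + 1 / (2 * \<delta>) \<le> 2 ^ q"
    by (simp add: powr_realpow)
  moreover have "0 < 1 / (2 * \<delta>)"
    using assms by simp
  \<comment> \<open>At least two extra qubits, so that \<open>K\<close> below is at least 2 and
    \<open>real K - 1\<close> is positive.\<close>
  ultimately have "(2::real) ^ 1 < 2 ^ q"
    unfolding power_one_right by linarith
  then have "1 < q"
    by (simp only: power_strict_increasing_iff)
  then obtain r where r: "q = Suc r" "1 \<le> r"
    by (cases q) auto
  define K :: nat where "K = 2 ^ r"
  have m: "m = n + Suc r"
    by (simp add: m_def boosted_size_def q_def[symmetric] r)
  have K: "2 \<le> K"
    using r power_increasing[of 1 r "2::nat"] by (simp add: K_def)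
  \<comment> \<open>Half of the bound \<open>q\<close>; equivalently,
    \<open>1 / (4 * (real K - 1))\<close> is at most \<open>\<delta>\<close>.\<close>
  have K': "1 + 1 / (4 * \<delta>) \<le> real K"
    using q by (simp add: r K_def)
  have tol: "real K / real (2 ^ m) = 1 / 2 ^ (n + 1)"
    by (simp add: m K_def power_add)
  let ?\<theta> = "outcome_sign b * (\<omega>\<^sub>0 * T)"
  define Bad where "Bad = {j. j < 2 ^ m \<and> \<not> (\<exists>z::int. \<bar>real j / real (2 ^ m) - ?\<theta> - of_int z\<bar> \<le> real K / real (2 ^ m))}"
  have tail: "(\<Sum>j\<in>Bad. (cmod (phase_sum (2 ^ m) (?\<theta> - real j / real (2 ^ m))))\<^sup>2 / (real (2 ^ m))\<^sup>2) \<le> \<delta>"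
  proof (cases n)
    \<comment> \<open>Here \<open>2 ^ m\<close> is only \<open>2 * K\<close>, outside the range of
      \<open>far_readout_le\<close>. But the tolerance is 1/2, so rounding makes every readout
      accurate.\<close>
    case 0
    have "Bad = {}"
    proof -
      have "\<bar>real j / real (2 ^ m) - ?\<theta> - of_int (round (real j / real (2 ^ m) - ?\<theta>))\<bar> \<le> real K / real (2 ^ m)" for j
        using of_int_round_abs_le[of "real j / real (2 ^ m) - ?\<theta>"] unfolding tol 0
        by (simp add: abs_minus_commute)
      then show ?thesis
        unfolding Bad_def by blast
    qed
    then show ?thesis
      using assms by simp
  next
    case (Suc n')
    have N: "2 ^ m = 4 * K * 2 ^ n'"
      by (simp add: m Suc K_def power_add)
    have "4 * K * 1 \<le> 2 ^ m"
      unfolding N by (intro mult_left_mono) auto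
    then have "4 * K \<le> 2 ^ m" "8 \<le> (2 ^ m :: nat)"
      using K by linarith+
    then have "(\<Sum>j\<in>Bad. (cmod (phase_sum (2 ^ m) (?\<theta> - real j / real (2 ^ m))))\<^sup>2 / (real (2 ^ m))\<^sup>2)
        \<le> real K / (4 * ((real K)\<^sup>2 - 1 / 4))"
      unfolding Bad_def using K by (intro far_readout_le) auto
    also have "\<dots> \<le> 1 / (4 * (real K - 1))"
    proof -
      have K1: "1 < real K"
        using K by simp
      then have K2: "1 < (real K)\<^sup>2"
        by simp
      have "real K * (4 * (real K - 1)) \<le> 4 * ((real K)\<^sup>2 - 1 / 4)"
        using K1 by (simp add: power2_eq_square algebra_simps)
      then have "real K \<le> 4 * ((real K)\<^sup>2 - 1 / 4) / (4 * (real K - 1))"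
        using K1 by (subst pos_le_divide_eq) auto
      then show ?thesis
        using K2 by (subst pos_divide_le_eq) auto
    qed
    also have "\<dots> \<le> \<delta>"
      using K' K assms by (simp add: field_simps)
    finally show ?thesis .
  qed
  let ?A = "{j. accurate_to_bits n \<omega>\<^sub>0 T (time_estimate m \<omega>\<^sub>0 b j)}"
  have Bad_eq: "Bad = {..<2 ^ m} - ?A"
    unfolding Bad_def tol accurate_time_estimate_iff[OF assms(1)] by auto
  \<comment> \<open>Values from \<open>2 ^ m\<close> on have probability 0, so failure is
    concentrated on \<open>Bad\<close>.\<close>
  have "measure_pmf.prob (readout m \<omega>\<^sub>0 T b) (- ?A) = measure_pmf.prob (readout m \<omega>\<^sub>0 T b) Bad"
    by (rule measure_prob_cong_0) (auto simp: Bad_eq pmf_readout)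
  also have "\<dots> = (\<Sum>j\<in>Bad. pmf (readout m \<omega>\<^sub>0 T b) j)"
    by (rule measure_measure_pmf_finite) (simp add: Bad_def)
  also have "\<dots> \<le> \<delta>"
    using tail by (simp add: pmf_readout Bad_def)
  finally have "measure_pmf.prob (readout m \<omega>\<^sub>0 T b) (- ?A) \<le> \<delta>" .
  then show ?thesis
    using measure_pmf.prob_compl[of ?A "readout m \<omega>\<^sub>0 T b"] by (simp add: m_def Compl_eq_Diff_UNIV)
qed

theorem mainTheorem2:
  fixes \<omega>\<^sub>0 :: real
  assumes "\<omega>\<^sub>0 > 0"
  shows
    "(\<exists>C. \<forall>(n::nat) (T::real).
        (\<forall>(b, t, tr) \<in> set_pmf (one_photon_run n \<omega>\<^sub>0 T). \<exists>F. tr = [Qubit Alice Bob F]) \<and>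
        frequency_range (one_photon_run n \<omega>\<^sub>0 T) \<le> C * 2 ^ n \<and>
        \<P>((b, t, tr) in one_photon_run n \<omega>\<^sub>0 T. accurate_to_bits n \<omega>\<^sub>0 T t) \<ge> 4 / pi\<^sup>2 \<and>
        (\<forall>c. \<P>(x in one_photon_run n \<omega>\<^sub>0 T.
                accurate_to_bits n \<omega>\<^sub>0 T (fst (snd x)) \<bar> fst x = c) \<ge> 4 / pi\<^sup>2)) \<and>
     (\<forall>\<delta>::real. 0 < \<delta> \<and> \<delta> < 1 \<longrightarrow>
       (\<exists>C. \<forall>(n::nat) (T::real).
        (\<forall>(b, t, tr) \<in> set_pmf (one_photon_run (boosted_size n \<delta>) \<omega>\<^sub>0 T).
           \<exists>F. tr = [Qubit Alice Bob F]) \<and>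
        frequency_range (one_photon_run (boosted_size n \<delta>) \<omega>\<^sub>0 T) \<le> C * 2 ^ n \<and>
        \<P>((b, t, tr) in one_photon_run (boosted_size n \<delta>) \<omega>\<^sub>0 T.
            accurate_to_bits n \<omega>\<^sub>0 T t) \<ge> 1 - \<delta> \<and>
        (\<forall>c. \<P>(x in one_photon_run (boosted_size n \<delta>) \<omega>\<^sub>0 T.
                accurate_to_bits n \<omega>\<^sub>0 T (fst (snd x)) \<bar> fst x = c) \<ge> 1 - \<delta>)))"
proof (intro conjI allI impI)
  have log: "\<forall>(b, t, tr) \<in> set_pmf (one_photon_run m \<omega>\<^sub>0 T). \<exists>F. tr = [Qubit Alice Bob F]" for m T
    by (auto dest!: run_log_support simp: run_log_def)
  note range = frequency_range_one_photon_run[OF assms]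
  note nearest = readout_accurate_nearest[OF assms]
  show "\<exists>C. \<forall>(n::nat) (T::real).
      (\<forall>(b, t, tr) \<in> set_pmf (one_photon_run n \<omega>\<^sub>0 T). \<exists>F. tr = [Qubit Alice Bob F]) \<and>
      frequency_range (one_photon_run n \<omega>\<^sub>0 T) \<le> C * 2 ^ n \<and>
      \<P>((b, t, tr) in one_photon_run n \<omega>\<^sub>0 T. accurate_to_bits n \<omega>\<^sub>0 T t) \<ge> 4 / pi\<^sup>2 \<and>
      (\<forall>c. \<P>(x in one_photon_run n \<omega>\<^sub>0 T.
              accurate_to_bits n \<omega>\<^sub>0 T (fst (snd x)) \<bar> fst x = c) \<ge> 4 / pi\<^sup>2)"
    by (intro exI[of _ \<omega>\<^sub>0] allI conjI log range prob_one_photon_run_accurate nearest)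
  fix \<delta> :: real
  assume \<delta>: "0 < \<delta> \<and> \<delta> < 1"
  then have "0 < \<delta>" by simp
  note boosted = readout_accurate_boosted[OF assms this]
  \<comment> \<open>The number of extra qubits depends on \<open>\<delta>\<close> alone, so
    \<open>\<omega>\<^sub>0 * 2 ^ q\<close> is a constant uniform in \<open>n\<close> and
    \<open>T\<close>.\<close>
  define q where "q = nat \<lceil>log 2 (2 + 1 / (2 * \<delta>))\<rceil>"
  have range': "frequency_range (one_photon_run (boosted_size n \<delta>) \<omega>\<^sub>0 T) \<le> (\<omega>\<^sub>0 * 2 ^ q) * 2 ^ n" for n T
    using range[of "boosted_size n \<delta>" T] by (simp add: boosted_size_def q_def power_add mult_ac)
  show "\<exists>C. \<forall>(n::nat) (T::real).
      (\<forall>(b, t, tr) \<in> set_pmf (one_photon_run (boosted_size n \<delta>) \<omega>\<^sub>0 T). \<exists>F. tr = [Qubit Alice Bob F]) \<and>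
      frequency_range (one_photon_run (boosted_size n \<delta>) \<omega>\<^sub>0 T) \<le> C * 2 ^ n \<and>
      \<P>((b, t, tr) in one_photon_run (boosted_size n \<delta>) \<omega>\<^sub>0 T. accurate_to_bits n \<omega>\<^sub>0 T t) \<ge> 1 - \<delta> \<and>
      (\<forall>c. \<P>(x in one_photon_run (boosted_size n \<delta>) \<omega>\<^sub>0 T.
              accurate_to_bits n \<omega>\<^sub>0 T (fst (snd x)) \<bar> fst x = c) \<ge> 1 - \<delta>)"
    by (intro exI[of _ "\<omega>\<^sub>0 * 2 ^ q"] allI conjI log range' prob_one_photon_run_accurate boosted)
qed

end
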